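(* Let $\varphi_1,\dots,\varphi_m\in\mathbb{R}^N$, $y_1,\dots,y_m\in\{-1,+1\}$ and $\rho>0$. The optimal solution $w^*$ of the soft-margin SVM problem $$\min_{w\in\mathbb{R}^N,\ \zeta\in\mathbb{R}^m}\ \frac12w^\top w+\rho\,e^\top\zeta\quad\text{s.t.}\quad y_i(\varphi_i^\top w)\ge1-\zeta_i,\ \ \zeta_i\ge0,\quad i=1,\dots,m,$$ can be recovered as $$w^*=\sum_{i=1}^m z_i^*y_i\varphi_i,$$ where $z^*$ is the optimal solution of the box-constrained QP $$\min_{z\in\mathbb{R}^m}\ \frac12\Big(\sum_{i=1}^m z_iy_i\varphi_i\Big)^{\!\top}\Big(\sum_{i=1}^m z_iy_i\varphi_i\Big)-\sum_{i=1}^m z_i\quad\text{s.t.}\quad 0\le z_i\le\rho,\ \ i=1,\dots,m.$$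
   Context: $e$ is the all-ones vector in $\mathbb{R}^m$. The $\varphi_i=\varphi(x_i)$ are the feature vectors of the training instances $x_i$ (augmented by a constant entry $1$, so that the bias term is absorbed in $w$), and $y_i$ are the labels. *)

theory Defs
  imports "HOL-Analysis.Analysis"
begin

(* The dimensions m (training instances) and N (features) are the cardinalities of the
   finite index types 'm and 'n. The all-ones vector e is "vec 1". *)

definition svm_objective :: "real \<Rightarrow> (real^'n) \<times> (real^'m) \<Rightarrow> real" where
  "svm_objective \<rho> = (\<lambda>(w, \<zeta>). 1/2 * (w \<bullet> w) + \<rho> * (vec 1 \<bullet> \<zeta>))"

definition svm_feasible ::
  "('m \<Rightarrow> real^'n) \<Rightarrow> ('m \<Rightarrow> real) \<Rightarrow> (real^'n) \<times> (real^'m) \<Rightarrow> bool" where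
  "svm_feasible \<phi> y = (\<lambda>(w, \<zeta>). \<forall>i. y i * (\<phi> i \<bullet> w) \<ge> 1 - \<zeta> $ i \<and> \<zeta> $ i \<ge> 0)"

definition svm_optimal ::
  "('m \<Rightarrow> real^'n) \<Rightarrow> ('m \<Rightarrow> real) \<Rightarrow> real \<Rightarrow> real^'n \<Rightarrow> real^'m \<Rightarrow> bool" where
  "svm_optimal \<phi> y \<rho> w \<zeta> \<longleftrightarrow>
     is_arg_min (svm_objective \<rho>) (svm_feasible \<phi> y) (w, \<zeta>)"

definition svm_combination ::
  "('m \<Rightarrow> real^'n) \<Rightarrow> ('m \<Rightarrow> real) \<Rightarrow> real^'m \<Rightarrow> real^'n" where
  "svm_combination \<phi> y z = (\<Sum>i\<in>UNIV. (z $ i * y i) *\<^sub>R \<phi> i)"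

definition box_qp_objective ::
  "('m \<Rightarrow> real^'n) \<Rightarrow> ('m \<Rightarrow> real) \<Rightarrow> real^'m \<Rightarrow> real" where
  "box_qp_objective \<phi> y z =
     1/2 * (svm_combination \<phi> y z \<bullet> svm_combination \<phi> y z) - (\<Sum>i\<in>UNIV. z $ i)"

definition box_qp_feasible :: "real \<Rightarrow> real^'m \<Rightarrow> bool" where
  "box_qp_feasible \<rho> z \<longleftrightarrow> (\<forall>i. 0 \<le> z $ i \<and> z $ i \<le> \<rho>)"

definition box_qp_optimal ::
  "('m \<Rightarrow> real^'n) \<Rightarrow> ('m \<Rightarrow> real) \<Rightarrow> real \<Rightarrow> real^'m \<Rightarrow> bool" where
  "box_qp_optimal \<phi> y \<rho> z \<longleftrightarrow> is_arg_min (box_qp_objective \<phi> y) (box_qp_feasible \<rho>) z"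

end

theory Submission
  imports Defs
begin

text \<open>
  The box-constrained QP is, up to sign, the Lagrangian dual of the SVM problem, and the whole
  statement follows from one sharpened duality inequality. Let \<open>z\<close> lie in the box and put
  \<open>u = svm_combination \<phi> y z\<close>. Relaxing the margin constraints with the multipliers \<open>z\<close> and
  completing the square in \<open>w\<close> bounds the SVM objective at every feasible \<open>(w, \<zeta>)\<close> from below by
  the dual value of \<open>z\<close> plus \<open>\<parallel>w - u\<parallel>\<^sup>2 / 2\<close> (lemma \<open>weak_duality_with_gap\<close>).

  If \<open>z\<close> is moreover optimal for the QP, then \<open>u\<close> together with its hinge losses attains the dual
  value, so that there is no duality gap (lemma \<open>hinge_slack_attains_dual_value\<close>). Here the
  first-order condition at \<open>z\<close>, tested against a single vertex of the box, supplies complementary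
  slackness. Hence \<open>u\<close> is an optimal weight vector, and the term \<open>\<parallel>w - u\<parallel>\<^sup>2 / 2\<close> excludes every
  other one. An optimal \<open>z\<close> exists because the box is compact and the QP objective continuous.
\<close>

lemma linear_svm_combination: "linear (svm_combination \<phi> y)"
  by (rule linearI)
    (simp_all add: svm_combination_def distrib_right scaleR_add_left sum.distrib
      scaleR_sum_right mult.assoc)

lemma inner_svm_combination:
  "svm_combination \<phi> y z \<bullet> w = (\<Sum>i\<in>UNIV. z $ i * (y i * (\<phi> i \<bullet> w)))"
  by (simp add: svm_combination_def inner_sum_left mult.assoc)

lemma svm_objective_eq:
  "svm_objective \<rho> (w, \<zeta>) = 1/2 * (w \<bullet> w) + \<rho> * (\<Sum>i\<in>UNIV. \<zeta> $ i)"
  by (simp add: svm_objective_def inner_vec_def)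

text \<open>
  Multiplying the margin constraints by \<open>z\<^sub>i \<ge> 0\<close> and using \<open>\<rho> \<zeta>\<^sub>i \<ge> z\<^sub>i \<zeta>\<^sub>i\<close> eliminates the slacks
  and leaves the Lagrangian \<open>\<parallel>w\<parallel>\<^sup>2 / 2 - u \<bullet> w + \<Sum>\<^sub>i z\<^sub>i\<close>. Its exact form, rather than only its
  minimum over \<open>w\<close>, is kept because the square measures the distance to the recovered solution.
\<close>

lemma weak_duality_with_gap:
  assumes feas: "svm_feasible \<phi> y (w, \<zeta>)" and box: "box_qp_feasible \<rho> z"
  defines "u \<equiv> svm_combination \<phi> y z"
  shows "1/2 * ((w - u) \<bullet> (w - u)) - box_qp_objective \<phi> y z \<le> svm_objective \<rho> (w, \<zeta>)"
proof -
  have "z $ i - z $ i * (y i * (\<phi> i \<bullet> w)) \<le> \<rho> * \<zeta> $ i" for i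
  proof -
    have "1 - y i * (\<phi> i \<bullet> w) \<le> \<zeta> $ i" "0 \<le> \<zeta> $ i"
      using feas by (auto simp: svm_feasible_def algebra_simps)
    moreover have "0 \<le> z $ i" "z $ i \<le> \<rho>"
      using box by (auto simp: box_qp_feasible_def)
    ultimately have "z $ i * (1 - y i * (\<phi> i \<bullet> w)) \<le> z $ i * \<zeta> $ i"
      and "z $ i * \<zeta> $ i \<le> \<rho> * \<zeta> $ i"
      by (auto intro: mult_left_mono mult_right_mono)
    then show ?thesis by (simp add: right_diff_distrib)
  qed
  then have "(\<Sum>i\<in>UNIV. z $ i - z $ i * (y i * (\<phi> i \<bullet> w))) \<le> (\<Sum>i\<in>UNIV. \<rho> * \<zeta> $ i)"
    by (rule sum_mono)
  then have "(\<Sum>i\<in>UNIV. z $ i) - u \<bullet> w \<le> \<rho> * (\<Sum>i\<in>UNIV. \<zeta> $ i)"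
    by (simp add: u_def inner_svm_combination sum_subtractf sum_distrib_left)
  then show ?thesis
    by (simp add: svm_objective_eq box_qp_objective_def u_def[symmetric] inner_diff_left
        inner_diff_right inner_commute algebra_simps)
qed

lemma linear_coeff_nonneg:
  fixes a b :: real
  assumes nonneg: "\<And>s. 0 < s \<Longrightarrow> s \<le> 1 \<Longrightarrow> 0 \<le> s * a + s\<^sup>2 * b"
  shows "0 \<le> a"
proof (rule ccontr)
  assume "\<not> 0 \<le> a"
  have "0 \<le> a + b" using nonneg[of 1] by simp
  with \<open>\<not> 0 \<le> a\<close> have "0 < b" by simp
  \<comment> \<open>The minimiser of the quadratic lies in the unit interval, and the value there is negative.\<close>
  define s where "s = - a / (2 * b)"
  have "0 < s" "s \<le> 1"
    using \<open>0 < b\<close> \<open>0 \<le> a + b\<close> \<open>\<not> 0 \<le> a\<close> by (auto simp: s_def field_simps)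
  moreover have "s * b = - a / 2"
    using \<open>0 < b\<close> by (simp add: s_def)
  then have "s * a + s\<^sup>2 * b = s * (a / 2)"
    by (simp add: power2_eq_square mult.assoc flip: distrib_left)
  moreover have "s * (a / 2) < 0"
    using \<open>0 < s\<close> \<open>\<not> 0 \<le> a\<close> by (intro mult_pos_neg) auto
  ultimately show False
    using nonneg[of s] by linarith
qed

text \<open>
  The variational inequality of a convex program: along the segment from an optimal \<open>z\<close> to
  another point \<open>x\<close> of the box the objective is a quadratic with nonnegative increment, so its
  slope at \<open>z\<close> is nonnegative.
\<close>

lemma box_qp_first_order_condition:
  assumes opt: "box_qp_optimal \<phi> y \<rho> z" and box: "box_qp_feasible \<rho> x"
  defines "u \<equiv> svm_combination \<phi> y z"
  shows "0 \<le> (\<Sum>i\<in>UNIV. (x $ i - z $ i) * (y i * (\<phi> i \<bullet> u) - 1))"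
proof -
  define d where "d = svm_combination \<phi> y (x - z)"
  define a where "a = d \<bullet> u - (\<Sum>i\<in>UNIV. (x - z) $ i)"
  have "0 \<le> s * a + s\<^sup>2 * (1/2 * (d \<bullet> d))" if s: "0 < s" "s \<le> 1" for s
  proof -
    let ?p = "z + s *\<^sub>R (x - z)"
    have zbox: "0 \<le> z $ i" "z $ i \<le> \<rho>" and xbox: "0 \<le> x $ i" "x $ i \<le> \<rho>" for i
      using opt box by (auto simp: box_qp_optimal_def is_arg_min_def box_qp_feasible_def)
    have "box_qp_feasible \<rho> ?p"
      unfolding box_qp_feasible_def
    proof
      fix i
      have "?p $ i = (1 - s) * z $ i + s * x $ i" by (simp add: algebra_simps)
      moreover have "0 \<le> (1 - s) * z $ i + s * x $ i" using s zbox xbox by simp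
      moreover have "(1 - s) * z $ i + s * x $ i \<le> \<rho>"
        using s zbox xbox by (intro convex_bound_le) auto
      ultimately show "0 \<le> ?p $ i \<and> ?p $ i \<le> \<rho>" by simp
    qed
    then have "box_qp_objective \<phi> y z \<le> box_qp_objective \<phi> y ?p"
      using opt by (auto simp: box_qp_optimal_def is_arg_min_def not_less)
    moreover have "svm_combination \<phi> y ?p = u + s *\<^sub>R d"
      by (simp only: u_def d_def linear_add[OF linear_svm_combination]
          linear_scale[OF linear_svm_combination])
    moreover have "(\<Sum>i\<in>UNIV. ?p $ i) = (\<Sum>i\<in>UNIV. z $ i) + s * (\<Sum>i\<in>UNIV. (x - z) $ i)"
      by (simp add: sum.distrib sum_distrib_left)
    ultimately show ?thesis
      by (simp add: box_qp_objective_def a_def u_def[symmetric] inner_add_left inner_add_right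
          inner_commute power2_eq_square algebra_simps)
  qed
  then have "0 \<le> a" by (rule linear_coeff_nonneg)
  then show ?thesis
    by (simp add: a_def d_def inner_svm_combination right_diff_distrib sum_subtractf)
qed

definition hinge_slack :: "('m \<Rightarrow> real^'n) \<Rightarrow> ('m \<Rightarrow> real) \<Rightarrow> real^'n \<Rightarrow> real^'m" where
  "hinge_slack \<phi> y w = (\<chi> i. max 0 (1 - y i * (\<phi> i \<bullet> w)))"

lemma svm_feasible_hinge_slack: "svm_feasible \<phi> y (w, hinge_slack \<phi> y w)"
  by (auto simp: svm_feasible_def hinge_slack_def)

text \<open>
  Complementary slackness in aggregated form. Testing the first-order condition against the vertex
  of the box that maximises \<open>\<Sum>\<^sub>i x\<^sub>i (1 - y\<^sub>i (\<phi>\<^sub>i \<bullet> u))\<close> shows that \<open>z\<close> attains this maximum,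
  which is exactly \<open>\<rho>\<close> times the total hinge loss of \<open>u\<close>.
\<close>

lemma hinge_slack_attains_dual_value:
  fixes \<phi> :: "'m::finite \<Rightarrow> real^'n"
  assumes opt: "box_qp_optimal \<phi> y \<rho> z" and "0 \<le> \<rho>"
  defines "u \<equiv> svm_combination \<phi> y z"
  shows "svm_objective \<rho> (u, hinge_slack \<phi> y u) \<le> - box_qp_objective \<phi> y z"
proof -
  define x :: "real^'m" where "x = (\<chi> i. if y i * (\<phi> i \<bullet> u) < 1 then \<rho> else 0)"
  have "box_qp_feasible \<rho> x"
    using \<open>0 \<le> \<rho>\<close> by (simp add: box_qp_feasible_def x_def)
  then have "0 \<le> (\<Sum>i\<in>UNIV. (x $ i - z $ i) * (y i * (\<phi> i \<bullet> u) - 1))"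
    unfolding u_def by (rule box_qp_first_order_condition[OF opt])
  moreover have "(x $ i - z $ i) * (y i * (\<phi> i \<bullet> u) - 1)
      = z $ i - z $ i * (y i * (\<phi> i \<bullet> u)) - \<rho> * hinge_slack \<phi> y u $ i" for i
    by (cases "y i * (\<phi> i \<bullet> u) < 1")
      (simp_all add: x_def hinge_slack_def left_diff_distrib right_diff_distrib)
  moreover have "u \<bullet> u = (\<Sum>i\<in>UNIV. z $ i * (y i * (\<phi> i \<bullet> u)))"
    unfolding u_def by (rule inner_svm_combination)
  ultimately have "0 \<le> (\<Sum>i\<in>UNIV. z $ i) - u \<bullet> u - \<rho> * (\<Sum>i\<in>UNIV. hinge_slack \<phi> y u $ i)"
    by (simp add: sum_subtractf sum_distrib_left)
  then show ?thesis
    by (simp add: svm_objective_eq box_qp_objective_def u_def[symmetric])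
qed

lemma box_qp_optimal_exists:
  fixes \<phi> :: "'m::finite \<Rightarrow> real^'n"
  assumes "0 \<le> \<rho>"
  shows "\<exists>z. box_qp_optimal \<phi> y \<rho> z"
proof -
  have box: "box_qp_feasible \<rho> z \<longleftrightarrow> z \<in> cbox 0 (vec \<rho>)" for z :: "real^'m"
    by (simp add: box_qp_feasible_def mem_box_cart)
  have "continuous_on (cbox 0 (vec \<rho>)) (box_qp_objective \<phi> y)"
    unfolding box_qp_objective_def svm_combination_def by (intro continuous_intros)
  moreover have "cbox 0 (vec \<rho>) \<noteq> ({} :: (real^'m) set)"
    using \<open>0 \<le> \<rho>\<close> by (simp add: interval_ne_empty_cart)
  ultimately have "\<exists>z \<in> cbox 0 (vec \<rho>). \<forall>x \<in> cbox 0 (vec \<rho>).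
      box_qp_objective \<phi> y z \<le> box_qp_objective \<phi> y x"
    by (intro continuous_attains_inf compact_cbox)
  then show ?thesis
    by (auto simp: box_qp_optimal_def is_arg_min_def box not_less)
qed

lemma svm_optimal_svm_combination:
  assumes opt: "box_qp_optimal \<phi> y \<rho> z" and "0 \<le> \<rho>"
  defines "u \<equiv> svm_combination \<phi> y z"
  shows "svm_optimal \<phi> y \<rho> u (hinge_slack \<phi> y u)"
proof -
  have box: "box_qp_feasible \<rho> z"
    using opt by (simp add: box_qp_optimal_def is_arg_min_def)
  have "svm_objective \<rho> (u, hinge_slack \<phi> y u) \<le> svm_objective \<rho> (w, \<zeta>)"
    if feas: "svm_feasible \<phi> y (w, \<zeta>)" for w \<zeta>
  proof -
    have "0 \<le> (w - u) \<bullet> (w - u)" by simp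
    then show ?thesis
      using weak_duality_with_gap[OF feas box]
        hinge_slack_attains_dual_value[OF opt \<open>0 \<le> \<rho>\<close>]
      unfolding u_def by linarith
  qed
  then show ?thesis
    by (auto simp: svm_optimal_def is_arg_min_def not_less svm_feasible_hinge_slack)
qed

text \<open>
  An optimal \<open>(w, \<zeta>)\<close> costs no more than \<open>u\<close> with its hinge losses, hence no more than the dual
  value, which leaves no room for the term \<open>\<parallel>w - u\<parallel>\<^sup>2 / 2\<close>.
\<close>

lemma svm_optimal_eq_svm_combination:
  assumes w: "svm_optimal \<phi> y \<rho> w \<zeta>" and opt: "box_qp_optimal \<phi> y \<rho> z" and "0 \<le> \<rho>"
  shows "w = svm_combination \<phi> y z"
proof -
  let ?u = "svm_combination \<phi> y z"
  have box: "box_qp_feasible \<rho> z"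
    using opt by (simp add: box_qp_optimal_def is_arg_min_def)
  have feas: "svm_feasible \<phi> y (w, \<zeta>)"
    and "svm_objective \<rho> (w, \<zeta>) \<le> svm_objective \<rho> (?u, hinge_slack \<phi> y ?u)"
    using w svm_feasible_hinge_slack[of \<phi> y ?u]
    by (auto simp: svm_optimal_def is_arg_min_def not_less)
  then have "(w - ?u) \<bullet> (w - ?u) \<le> 0"
    using weak_duality_with_gap[OF feas box] hinge_slack_attains_dual_value[OF opt \<open>0 \<le> \<rho>\<close>]
    by linarith
  then have "(w - ?u) \<bullet> (w - ?u) = 0"
    by (intro antisym inner_ge_zero)
  then show ?thesis by simp
qed

theorem lemma7:
  fixes \<phi> :: "'m::finite \<Rightarrow> real^'n" and y :: "'m \<Rightarrow> real" and \<rho> :: real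
  assumes "\<And>i. y i \<in> {-1, 1}" and "\<rho> > 0"
  shows "(\<exists>!w. \<exists>\<zeta>. svm_optimal \<phi> y \<rho> w \<zeta>) \<and>
         (\<exists>z. box_qp_optimal \<phi> y \<rho> z) \<and>
         (\<forall>w \<zeta> z. svm_optimal \<phi> y \<rho> w \<zeta> \<and> box_qp_optimal \<phi> y \<rho> z \<longrightarrow>
            w = (\<Sum>i\<in>UNIV. (z $ i * y i) *\<^sub>R \<phi> i))"
proof -
  have "0 \<le> \<rho>" using \<open>\<rho> > 0\<close> by simp
  obtain z where z: "box_qp_optimal \<phi> y \<rho> z"
    using box_qp_optimal_exists[OF \<open>0 \<le> \<rho>\<close>] by blast
  have "\<exists>!w. \<exists>\<zeta>. svm_optimal \<phi> y \<rho> w \<zeta>"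
    using svm_optimal_svm_combination[OF z \<open>0 \<le> \<rho>\<close>]
      svm_optimal_eq_svm_combination[OF _ z \<open>0 \<le> \<rho>\<close>] by blast
  moreover have "\<forall>w \<zeta> z. svm_optimal \<phi> y \<rho> w \<zeta> \<and> box_qp_optimal \<phi> y \<rho> z \<longrightarrow>
      w = (\<Sum>i\<in>UNIV. (z $ i * y i) *\<^sub>R \<phi> i)"
    using svm_optimal_eq_svm_combination[OF _ _ \<open>0 \<le> \<rho>\<close>]
    unfolding svm_combination_def by blast
  ultimately show ?thesis using z by blast
qed

end
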